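(* Let $G$ be a $C_{4k}$-free bipartite graph. Then (1) $\operatorname{In}(G)=\left(\operatorname{core}(G)+\frac{\operatorname{npart}(G)}{2},\ \operatorname{supp}(G)-\operatorname{core}(G),\ \operatorname{core}(G)+\frac{\operatorname{npart}(G)}{2}\right)$; (2) $\operatorname{In}(G)=\sum_{H\in\mathcal{K}(C_S(G))}\operatorname{In}(H)+\sum_{H\in\mathcal{K}(C_N(G))}\operatorname{In}(H)$ (sum of triples taken coordinatewise).
   Context: All graphs are finite, simple and undirected. A graph is a $C_{4k}$-free bipartite graph if it is bipartite and contains no cycle whose length is a multiple of $4$. The inertia $\operatorname{In}(G)=(a,b,c)$ of a graph $G$ consists of the number $a$ of negative eigenvalues, the multiplicity $b$ of $0$ as an eigenvalue, and the number $c$ of positive eigenvalues of its adjacency matrix (counted with multiplicity). $\operatorname{Supp}(G)$ is the set of vertices $v$ with $\vec{x}_v\neq0$ for some $\vec{x}$ in the null space of the adjacency matrix; $\operatorname{Core}(G)$ is the set of vertices adjacent to some vertex of $\operatorname{Supp}(G)$; $\operatorname{Npart}(G)=V(G)\setminus(\operatorname{Supp}(G)\cup\operatorname{Core}(G))$; $\operatorname{supp},\operatorname{core},\operatorname{npart}$ denote their cardinalities. $C_S(G)$ is the subgraph induced by $\operatorname{Supp}(G)\cup\operatorname{Core}(G)$, $C_N(G)$ the subgraph induced by $\operatorname{Npart}(G)$, and $\mathcal{K}(F)$ the set of connected components of $F$. *)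

theory Defs
  imports
    "Graph_Theory.Graph_Theory"
    "Jordan_Normal_Form.Char_Poly"
    "Jordan_Normal_Form.Matrix_Kernel"
    "HOL-Library.Product_Plus"
begin

text \<open>
  Finite simple undirected graphs are modelled as in the locale \<^locale>\<open>graph\<close>: finite
  symmetric digraphs without loops and without parallel arcs, where the edge \<open>{u, v}\<close>
  is the pair of arcs \<open>(u, v)\<close>, \<open>(v, u)\<close>.
\<close>

definition bipartite :: "('a, 'b) pre_digraph \<Rightarrow> bool" where
  "bipartite G \<longleftrightarrow> (\<exists>X Y. X \<union> Y = verts G \<and> X \<inter> Y = {} \<and>
     (\<forall>(u, v) \<in> arcs_ends G. u \<in> X \<and> v \<in> Y \<or> u \<in> Y \<and> v \<in> X))"

text \<open>
  In a symmetric digraph, traversing an edge back and forth is a \<^const>\<open>pre_digraph.cycle\<close> of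
  length 2.  The cycles of the undirected graph are those of length at least 3.
\<close>

definition undirected_cycle :: "('a, 'b) pre_digraph \<Rightarrow> 'b awalk \<Rightarrow> bool" where
  "undirected_cycle G p \<longleftrightarrow> pre_digraph.cycle G p \<and> 3 \<le> length p"

definition C4k_free_bipartite :: "('a, 'b) pre_digraph \<Rightarrow> bool" where
  "C4k_free_bipartite G \<longleftrightarrow> bipartite G \<and> \<not> (\<exists>p. undirected_cycle G p \<and> 4 dvd length p)"

text \<open>
  Matrices are indexed by natural numbers, so the vertices are enumerated by an arbitrary
  but fixed list.  Another enumeration conjugates the adjacency matrix by a permutation
  matrix, which affects neither \<open>inertia\<close> nor \<open>Supp\<close> below.
\<close>

definition vertex_list :: "('a, 'b) pre_digraph \<Rightarrow> 'a list" where
  "vertex_list G = (SOME vs. distinct vs \<and> set vs = verts G)"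

lemma vertex_list:
  assumes "finite (verts G)"
  shows "distinct (vertex_list G)" "set (vertex_list G) = verts G"
    "length (vertex_list G) = card (verts G)"
proof -
  have "\<exists>vs. distinct vs \<and> set vs = verts G"
    using finite_distinct_list[OF assms] by blast
  then have *: "distinct (vertex_list G) \<and> set (vertex_list G) = verts G"
    unfolding vertex_list_def by (rule someI_ex)
  then show "distinct (vertex_list G)" "set (vertex_list G) = verts G"
    by auto
  then show "length (vertex_list G) = card (verts G)"
    using distinct_card[of "vertex_list G"] by simp
qed

definition adj_matrix :: "('a, 'b) pre_digraph \<Rightarrow> real mat" where
  "adj_matrix G = mat (card (verts G)) (card (verts G))
     (\<lambda>(i, j). if vertex_list G ! i \<rightarrow>\<^bsub>G\<^esub> vertex_list G ! j then 1 else 0)"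

text \<open>
  The multiplicity of an eigenvalue is its multiplicity as a root of the characteristic
  polynomial.  All eigenvalues are real since the matrix is symmetric.
\<close>

definition inertia :: "('a, 'b) pre_digraph \<Rightarrow> nat \<times> nat \<times> nat" where
  "inertia G =
     (let A = adj_matrix G; m = (\<lambda>k. Polynomial.order k (char_poly A)) in
       (\<Sum>k | eigenvalue A k \<and> k < 0. m k, m 0, \<Sum>k | eigenvalue A k \<and> k > 0. m k))"

definition Supp :: "('a, 'b) pre_digraph \<Rightarrow> 'a set" where
  "Supp G = {vertex_list G ! i | i. i < card (verts G) \<and>
     (\<exists>x \<in> mat_kernel (adj_matrix G). x $ i \<noteq> 0)}"

definition Core :: "('a, 'b) pre_digraph \<Rightarrow> 'a set" where
  "Core G = {v \<in> verts G. \<exists>u \<in> Supp G. v \<rightarrow>\<^bsub>G\<^esub> u}"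

definition Npart :: "('a, 'b) pre_digraph \<Rightarrow> 'a set" where
  "Npart G = verts G - (Supp G \<union> Core G)"

definition supp :: "('a, 'b) pre_digraph \<Rightarrow> nat" where
  "supp G = card (Supp G)"

definition core :: "('a, 'b) pre_digraph \<Rightarrow> nat" where
  "core G = card (Core G)"

definition npart :: "('a, 'b) pre_digraph \<Rightarrow> nat" where
  "npart G = card (Npart G)"

definition C_S :: "('a, 'b) pre_digraph \<Rightarrow> ('a, 'b) pre_digraph" where
  "C_S G = G \<restriction> (Supp G \<union> Core G)"

definition C_N :: "('a, 'b) pre_digraph \<Rightarrow> ('a, 'b) pre_digraph" where
  "C_N G = G \<restriction> Npart G"

text \<open>The connected components are the maximal connected subgraphs.\<close>

definition components :: "('a, 'b) pre_digraph \<Rightarrow> ('a, 'b) pre_digraph set" where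
  "components F = {H. pre_digraph.max_subgraph F connected H}"

lemma components_eq_sccs:
  assumes "sym_digraph F"
  shows "components F = pre_digraph.sccs F"
proof -
  interpret sym_digraph F by fact
  have mono: "arc_mono (connected :: ('a, 'b) pre_digraph \<Rightarrow> bool)"
    unfolding arc_mono_def
    by (metis spanning_def subgraph_def wf_digraph.connected_spanning_imp_connected)
  have conn: "connected H" if "strongly_connected H" "wf_digraph H" for H :: "('a, 'b) pre_digraph"
    using that unfolding connected_def strongly_connected_def
    by (auto intro: wf_digraph.reachable_mk_symmetricI)
  have sc: "strongly_connected H" if "connected H" "induced_subgraph H F" for H
  proof -
    interpret H: sym_digraph H
      using that(2) by (rule induced_graph_imp_graph)
    show ?thesis
      using that(1) H.sym_arcs by (intro H.symmetric_connected_imp_strongly_connected)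
  qed
  have "max_subgraph connected H \<longleftrightarrow> max_subgraph strongly_connected H" for H
  proof
    assume H: "max_subgraph connected H"
    then have "strongly_connected H"
      using sc induced_subgraphI_arc_mono[OF H mono] max_subgraph_prop by blast
    then show "max_subgraph strongly_connected H"
      using H conn unfolding max_subgraph_def subgraph_def by metis
  next
    assume H: "max_subgraph strongly_connected H"
    then have sub: "subgraph H F" and "wf_digraph H"
      by (auto simp: max_subgraph_def)
    show "max_subgraph connected H"
    proof (rule max_subgraphI)
      show "connected H"
        using conn max_subgraph_prop[OF H] \<open>wf_digraph H\<close> by blast
      show "subgraph H F" by fact
      fix K assume K: "H \<noteq> K" "subgraph H K" "subgraph K F"
      show "\<not> connected K"
      proof
        assume "connected K"
        let ?K = "F \<restriction> verts K"
        have KK: "subgraph K ?K"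
          using K(3) by (rule subgraph_induce_subgraphI2)
        have vK: "verts K \<subseteq> verts F"
          using K(3) by (rule subgraph_imp_subverts)
        have ind: "induced_subgraph ?K F"
          using vK by (rule induced_induce)
        have "connected ?K"
          using mono KK \<open>connected K\<close> unfolding arc_mono_def by auto
        then have "strongly_connected ?K"
          using ind sc by blast
        moreover have HK: "subgraph H ?K"
          using K(2) KK by (rule subgraph_trans)
        moreover have "subgraph ?K F"
          using ind by auto
        ultimately have "H = ?K"
          using H unfolding max_subgraph_def by auto
        then have "K = H"
          using K(2) KK by (metis pre_digraph.equality subgraph_def compatible_def
              old.unit.exhaust subset_antisym)
        with K(1) show False by simp
      qed
    qed
  qed
  then show ?thesis
    unfolding components_def sccs_altdef2 by (intro Collect_cong)
qed

end

theory Submission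
  imports Defs
    "Jordan_Normal_Form.Jordan_Normal_Form_Existence"
    "Jordan_Normal_Form.Jordan_Normal_Form_Uniqueness"
begin

text \<open>
  The adjacency matrix is symmetric and, since \<open>G\<close> is bipartite, similar to its negative, so the
  inertia is determined by the order and the nullity.

  The only use of the absence of \<open>4k\<close>-cycles is a sign argument: if \<open>w\<close> is a real function on the
  vertices whose sum over the neighbours of \<open>v\<close> vanishes whenever \<open>w v \<noteq> 0\<close>, then its support is
  independent.  Applying this to functions that agree with one null vector on one colour class and
  with another function on the other class shows that \<open>Supp\<close> and \<open>Core\<close> are disjoint and that the
  columns of the \<open>Supp \<times> Core\<close> block of the adjacency matrix are independent.  Hence the nullity is
  \<open>supp - core\<close>, which gives (1).

  For (2), (1) is applied to every component \<open>H\<close>: the decomposition of a component of \<open>C_S G\<close> is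
  the restriction of that of \<open>G\<close>, and the components of \<open>C_N G\<close> are nonsingular.
\<close>

section \<open>Spectra of real symmetric matrices\<close>

text \<open>The polynomial splits over the complex numbers. For a root \<open>a\<close> with
  eigenvector \<open>v\<close>, moving the real symmetric matrix across
  \<open>v \<bullet>c v\<close> gives \<open>a = cnj a\<close>, so all roots are real and the
  factorization descends to the reals.\<close>

lemma symmetric_real_char_poly_splits:
  fixes A :: "real mat"
  assumes A: "A \<in> carrier_mat n n" and sym: "A\<^sup>T = A"
  shows "\<exists>as. char_poly A = (\<Prod>a\<leftarrow>as. [:- a, 1:])"
proof -
  interpret hp: map_poly_inj_comm_ring_hom complex_of_real ..
  let ?A = "map_mat complex_of_real A"
  have A': "?A \<in> carrier_mat n n" using A by simp
  obtain as where as: "char_poly ?A = (\<Prod>a\<leftarrow>as. [:- a, 1:])"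
    using char_poly_factorized[OF A'] by blast
  have "?A\<^sup>T = map_mat complex_of_real (A\<^sup>T)"
    by (rule eq_matI) auto
  then have sym': "?A\<^sup>T = ?A" by (simp only: sym)
  have real: "a \<in> \<real>" if "a \<in> set as" for a
  proof -
    have "poly (char_poly ?A) a = 0"
      unfolding as using that by (auto simp: poly_prod_list prod_list_zero_iff)
    then have "eigenvalue ?A a"
      using eigenvalue_root_char_poly[OF A'] by simp
    then obtain v where v: "v \<in> carrier_vec n" "v \<noteq> 0\<^sub>v n" and ev: "?A *\<^sub>v v = a \<cdot>\<^sub>v v"
      unfolding eigenvalue_def eigenvector_def using A by auto
    have cv: "conjugate v \<in> carrier_vec n" using v by simp
    have cA: "?A *\<^sub>v conjugate v = conjugate (?A *\<^sub>v v)"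
      using A v by (intro eq_vecI) (auto simp: scalar_prod_def)
    have "a * (v \<bullet>c v) = (a \<cdot>\<^sub>v v) \<bullet>c v" using v by simp
    also have "\<dots> = (?A\<^sup>T *\<^sub>v v) \<bullet> conjugate v"
      by (simp only: ev sym')
    also have "\<dots> = v \<bullet> (?A *\<^sub>v conjugate v)"
      by (rule transpose_vec_mult_scalar[OF A' cv v(1)])
    also have "\<dots> = v \<bullet> conjugate (a \<cdot>\<^sub>v v)" by (simp only: cA ev)
    also have "\<dots> = cnj a * (v \<bullet>c v)"
      using v by (simp add: conjugate_smult_vec)
    finally have "a = cnj a"
      using v conjugate_square_eq_0_vec by auto
    then show ?thesis by (simp add: Reals_cnj_iff)
  qed
  have "map complex_of_real (map Re as) = as"
    using real by (auto intro!: map_idI)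
  then have "char_poly ?A = (\<Prod>a\<leftarrow>map complex_of_real (map Re as). [:- a, 1:])"
    using as by simp
  also have "\<dots> = map_poly complex_of_real (\<Prod>a\<leftarrow>map Re as. [:- a, 1:])"
    by (simp add: hp.hom_prod_list o_def)
  finally have "map_poly complex_of_real (char_poly A)
      = map_poly complex_of_real (\<Prod>a\<leftarrow>map Re as. [:- a, 1:])"
    by (simp only: of_real_hom.char_poly_hom[OF A])
  then have "char_poly A = (\<Prod>a\<leftarrow>map Re as. [:- a, 1:])"
    by (rule hp.injectivity)
  then show ?thesis by (rule exI)
qed

lemma sum_order_split_poly:
  fixes as :: "'a :: field list"
  defines "p \<equiv> \<Prod>a\<leftarrow>as. [:- a, 1:]"
  shows "(\<Sum>k | poly p k = 0. Polynomial.order k p) = degree p"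
proof -
  have "Polynomial.order k p = count_list as k" for k
    unfolding p_def by (subst order_prod_list) (auto simp: o_def order_linear', induction as, auto)
  moreover have "{k. poly p k = 0} = set as"
    unfolding p_def by (auto simp: poly_prod_list prod_list_zero_iff)
  moreover have "degree p = length as"
    unfolding p_def by (rule degree_linear_factors)
  ultimately show ?thesis by (simp add: sum_count_set)
qed

text \<open>If \<open>A (A v) = 0\<close>, then symmetry gives
  \<open>(A v) \<bullet> (A v) = v \<bullet> (A (A v)) = 0\<close>, hence
  \<open>A v = 0\<close>.\<close>

lemma symmetric_real_mat_kernel_square:
  fixes A :: "real mat"
  assumes A: "A \<in> carrier_mat n n" and sym: "A\<^sup>T = A"
  shows "mat_kernel (A * A) = mat_kernel A"
proof (intro equalityI mat_kernel_mult_subset[OF A A] subsetI)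
  fix v assume "v \<in> mat_kernel (A * A)"
  then have v: "v \<in> carrier_vec n" and z: "A *\<^sub>v (A *\<^sub>v v) = 0\<^sub>v n"
    using A unfolding mat_kernel_def by auto
  have Av: "A *\<^sub>v v \<in> carrier_vec n" using A v by simp
  have "(A *\<^sub>v v) \<bullet>c (A *\<^sub>v v) = (A *\<^sub>v v) \<bullet> (A *\<^sub>v v)" by simp
  also have "\<dots> = (A\<^sup>T *\<^sub>v v) \<bullet> (A *\<^sub>v v)" by (simp only: sym)
  also have "\<dots> = v \<bullet> (A *\<^sub>v (A *\<^sub>v v))"
    by (rule transpose_vec_mult_scalar[OF A Av v])
  also have "\<dots> = 0" using v by (simp add: z)
  finally show "v \<in> mat_kernel A"
    using Av v A conjugate_square_eq_0_vec[OF Av] by (intro mat_kernelI[OF A]) auto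
qed

text \<open>The order is the total size of the Jordan blocks at 0, the kernel dimension their
  number. As \<open>A\<close> and \<open>A * A\<close> have the same kernel, no block at 0 is larger
  than 1, and the two agree.\<close>

lemma symmetric_real_order_0_char_poly:
  fixes A :: "real mat"
  assumes A: "A \<in> carrier_mat n n" and sym: "A\<^sup>T = A"
  shows "Polynomial.order 0 (char_poly A) = kernel_dim A"
proof -
  obtain n_as where jnf: "jordan_nf A n_as"
    using symmetric_real_char_poly_splits[OF assms] jordan_nf_exists[OF A] by blast
  define bs where "bs = map fst (filter (\<lambda>na. snd na = 0) n_as)"
  have gen: "dim_gen_eigenspace A 0 k = (\<Sum>n\<leftarrow>bs. min k n)" for k
    unfolding dim_gen_eigenspace[OF jnf] bs_def by (simp add: case_prod_beta')
  have char: "char_matrix A 0 = A"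
    using A by (intro eq_matI) (auto simp: char_matrix_def)
  have 1: "dim_gen_eigenspace A 0 1 = kernel_dim A"
    using A by (simp add: dim_gen_eigenspace_def char)
  have "A ^\<^sub>m 2 = A * A" using A by (simp add: numeral_2_eq_2)
  then have "dim_gen_eigenspace A 0 2 = kernel_dim A"
    using A by (simp add: dim_gen_eigenspace_def char kernel_dim_def
        symmetric_real_mat_kernel_square[OF assms])
  then have eq: "(\<Sum>n\<leftarrow>bs. min 2 n) = (\<Sum>n\<leftarrow>bs. min 1 n)"
    using 1 by (simp only: gen)
  \<comment> \<open>Stated for every list because the induction applies it to the tail: with equal
    totals, neither the head nor the tail can have a strict inequality.\<close>
  have le: "(\<Sum>n\<leftarrow>bs. min 1 n) \<le> (\<Sum>n\<leftarrow>bs. min 2 n)" for bs :: "nat list"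
    by (rule sum_list_mono) simp
  have "sum_list bs = (\<Sum>n\<leftarrow>bs. min 1 n)" using eq
  proof (induction bs)
    case (Cons b bs)
    then have "min 2 b = min 1 b" "(\<Sum>n\<leftarrow>bs. min 2 n) = (\<Sum>n\<leftarrow>bs. min 1 n)"
      using le[of bs] by auto
    with Cons.IH show ?case by simp
  qed simp
  then show ?thesis
    using 1 unfolding jordan_nf_order[OF jnf] bs_def[symmetric] gen by simp
qed

text \<open>Similar matrices share the characteristic polynomial, and negating \<open>A\<close>
  negates the eigenvalues of the Jordan blocks but keeps their sizes.\<close>

lemma order_char_poly_uminus:
  fixes A :: "real mat"
  assumes A: "A \<in> carrier_mat n n" and jnf: "jordan_nf A n_as" and sim: "similar_mat A ((-1) \<cdot>\<^sub>m A)"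
  shows "Polynomial.order (- k) (char_poly A) = Polynomial.order k (char_poly A)"
proof -
  have "Polynomial.order k (char_poly A) = Polynomial.order k (char_poly ((-1) \<cdot>\<^sub>m A))"
    by (simp only: char_poly_similar[OF sim])
  also have "\<dots> = sum_list (map fst (filter (\<lambda>na. snd na = k) (map (\<lambda>(n, a). (n, -1 * a)) n_as)))"
    by (rule jordan_nf_order[OF jordan_nf_smult[OF jnf]]) simp
  also have "\<dots> = sum_list (map fst (filter (\<lambda>na. snd na = - k) n_as))"
    by (induction n_as) auto
  also have "\<dots> = Polynomial.order (- k) (char_poly A)"
    by (rule jordan_nf_order[OF jnf, symmetric])
  finally show ?thesis by simp
qed

section \<open>Kernels and surjectivity of real linear systems\<close>

lemma vec_in_kernel_iff:
  assumes "N \<in> carrier_mat r n" "x \<in> carrier_vec n"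
  shows "x \<in> mat_kernel N \<longleftrightarrow> (\<forall>i<r. (N *\<^sub>v x) $ i = 0)"
proof -
  have "N *\<^sub>v x = 0\<^sub>v r \<longleftrightarrow> (\<forall>i<r. (N *\<^sub>v x) $ i = 0)"
    using assms(1) by (simp add: vec_eq_iff del: index_mult_mat_vec)
  then show ?thesis using assms by (simp add: mat_kernel)
qed

text \<open>Rank-nullity for a map whose image is the whole \<open>r\<close>-dimensional
  space.\<close>

lemma kernel_dim_surj:
  fixes N :: "'a :: field mat"
  assumes N: "N \<in> carrier_mat r n"
    and surj: "\<And>y. y \<in> carrier_vec r \<Longrightarrow> \<exists>x \<in> carrier_vec n. N *\<^sub>v x = y"
  shows "kernel_dim N + r = n"
proof -
  interpret V: vec_space "TYPE('a)" n .
  interpret W: vec_space "TYPE('a)" r .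
  interpret T: linear_map class_ring V.V W.V "\<lambda>v. N *\<^sub>v v"
    using N by unfold_locales
      (auto simp: LinearCombinations.module_hom_def mult_add_distrib_mat_vec[OF N] mult_mat_vec[OF N])
  have "T.im = carrier W.V"
    using surj N by (force simp: T.im_def)
  moreover have "T.ker = mat_kernel N"
    using N by (auto simp: T.ker_def mat_kernel_def)
  moreover have "W.V\<lparr>carrier := carrier W.V\<rparr> = W.V" by simp
  ultimately have "vectorspace.dim class_ring W.V + kernel_dim N = vectorspace.dim class_ring V.V"
    using T.rank_nullity[OF V.fin_dim] N by (simp only: kernel_dim_def carrier_matD)
  then show ?thesis by (simp only: V.dim_is_n W.dim_is_n add.commute)
qed

text \<open>The Gram matrix of linearly independent rows is nonsingular.\<close>

lemma independent_rows_surj: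
  fixes m :: "'a \<Rightarrow> 'b \<Rightarrow> real"
  assumes fin: "finite C" "finite S"
    and ind: "\<And>y. \<lbrakk>\<And>s. s \<in> S \<Longrightarrow> (\<Sum>c\<in>C. m c s * y c) = 0\<rbrakk> \<Longrightarrow> \<forall>c\<in>C. y c = 0"
  shows "\<exists>z. \<forall>c\<in>C. (\<Sum>s\<in>S. m c s * z s) = b c"
proof -
  obtain f where f: "bij_betw f {0..<card C} C"
    using ex_bij_betw_nat_finite[OF fin(1)] by blast
  define g where "g = the_inv_into {0..<card C} f"
  have gf: "g (f i) = i" if "i < card C" for i
    using f that unfolding g_def by (simp add: bij_betw_def the_inv_into_f_f)
  define K where "K = mat (card C) (card C) (\<lambda>(i, j). \<Sum>s\<in>S. m (f i) s * m (f j) s)"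
  have K: "K \<in> carrier_mat (card C) (card C)" by (simp add: K_def)
  have Kv: "(K *\<^sub>v v) $ i = (\<Sum>s\<in>S. m (f i) s * (\<Sum>c\<in>C. m c s * v $ g c))"
    if v: "v \<in> carrier_vec (card C)" and i: "i < card C" for v i
  proof -
    have "(K *\<^sub>v v) $ i = (\<Sum>j<card C. (\<Sum>s\<in>S. m (f i) s * m (f j) s) * v $ j)"
      using v i by (simp add: K_def scalar_prod_def atLeast0LessThan)
    also have "\<dots> = (\<Sum>j<card C. (\<Sum>s\<in>S. m (f i) s * m (f j) s) * v $ g (f j))"
      by (simp add: gf)
    also have "\<dots> = (\<Sum>c\<in>C. (\<Sum>s\<in>S. m (f i) s * m c s) * v $ g c)"
      using sum.reindex_bij_betw[OF f, of "\<lambda>c. (\<Sum>s\<in>S. m (f i) s * m c s) * v $ g c"]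
      by (simp add: atLeast0LessThan)
    also have "\<dots> = (\<Sum>s\<in>S. m (f i) s * (\<Sum>c\<in>C. m c s * v $ g c))"
      unfolding sum_distrib_right sum_distrib_left
      by (subst sum.swap) (simp add: mult.assoc)
    finally show ?thesis .
  qed
  have "det K \<noteq> 0"
  proof
    assume "det K = 0"
    then obtain v where v: "v \<in> carrier_vec (card C)" "v \<noteq> 0\<^sub>v (card C)" "K *\<^sub>v v = 0\<^sub>v (card C)"
      using det_0_iff_vec_prod_zero[OF K] by blast
    let ?t = "\<lambda>s. \<Sum>c\<in>C. m c s * v $ g c"
    have z: "(\<Sum>s\<in>S. m c s * ?t s) = 0" if "c \<in> C" for c
    proof -
      obtain i where "i \<in> {0..<card C}" "c = f i"
        using f \<open>c \<in> C\<close> by (metis bij_betw_imp_surj_on imageE)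
      then show ?thesis using Kv[OF v(1), of i] unfolding v(3) by simp
    qed
    \<comment> \<open>A kernel vector of the Gram matrix yields a combination \<open>?t\<close> of
      the rows that is orthogonal to every row, hence to itself. So \<open>?t\<close> vanishes and
      independence applies.\<close>
    have "(\<Sum>s\<in>S. ?t s * ?t s) = (\<Sum>s\<in>S. \<Sum>c\<in>C. v $ g c * (m c s * ?t s))"
      by (intro sum.cong refl) (simp add: sum_distrib_right mult_ac)
    also have "\<dots> = (\<Sum>c\<in>C. v $ g c * (\<Sum>s\<in>S. m c s * ?t s))"
      by (subst sum.swap) (simp add: sum_distrib_left)
    also have "\<dots> = 0" using z by simp
    finally have "\<forall>s\<in>S. ?t s * ?t s = 0"
      using fin(2) by (subst (asm) sum_nonneg_eq_0_iff) auto
    then have "\<forall>c\<in>C. v $ g c = 0" by (intro ind) simp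
    then have "v $ i = 0" if "i < card C" for i
    proof -
      have "f i \<in> C" using f that by (auto dest: bij_betwE)
      then have "v $ g (f i) = 0" using \<open>\<forall>c\<in>C. v $ g c = 0\<close> by blast
      then show ?thesis by (simp only: gf[OF that])
    qed
    then show False using v(1,2) by (auto intro!: eq_vecI)
  qed
  then obtain K' where K': "K' \<in> carrier_mat (card C) (card C)" "K * K' = 1\<^sub>m (card C)"
    using det_non_zero_imp_unit[OF K] by (auto simp: Units_def ring_mat_def)
  \<comment> \<open>The solution is sought as a combination of the rows; its coefficients solve the
    Gram system with right-hand side \<open>b\<close>.\<close>
  define v where "v = K' *\<^sub>v vec (card C) (\<lambda>i. b (f i))"
  have v: "v \<in> carrier_vec (card C)" using K' by (simp add: v_def)
  have "K *\<^sub>v v = vec (card C) (\<lambda>i. b (f i))"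
    unfolding v_def using K K' by (simp flip: assoc_mult_mat_vec)
  then have "(\<Sum>s\<in>S. m (f i) s * (\<Sum>c\<in>C. m c s * v $ g c)) = b (f i)" if "i < card C" for i
    using Kv[OF v that] that by simp
  then have "\<forall>i\<in>{0..<card C}. (\<Sum>s\<in>S. m (f i) s * (\<Sum>c\<in>C. m c s * v $ g c)) = b (f i)"
    by simp
  then have "\<forall>c\<in>f ` {0..<card C}. (\<Sum>s\<in>S. m c s * (\<Sum>c\<in>C. m c s * v $ g c)) = b c"
    unfolding ball_simps .
  then have "\<forall>c\<in>C. (\<Sum>s\<in>S. m c s * (\<Sum>c\<in>C. m c s * v $ g c)) = b c"
    by (simp only: bij_betw_imp_surj_on[OF f])
  then show ?thesis by (intro exI[of _ "\<lambda>s. \<Sum>c\<in>C. m c s * v $ g c"])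
qed

section \<open>Sign patterns along walks\<close>

text \<open>The entry at \<open>v\<close> of the adjacency matrix applied to \<open>x\<close>, free
  of the vertex enumeration.\<close>

definition nbsum :: "('a, 'b) pre_digraph \<Rightarrow> ('a \<Rightarrow> real) \<Rightarrow> 'a \<Rightarrow> real" where
  "nbsum G x v = (\<Sum>u | v \<rightarrow>\<^bsub>G\<^esub> u. x u)"

lemma (in fin_digraph) finite_neighbours: "finite {u. v \<rightarrow>\<^bsub>G\<^esub> u}"
  by (rule finite_subset[OF _ finite_verts]) (auto dest: adj_in_verts)

lemma (in pre_digraph) cas_map_arcs:
  assumes "\<And>k. tail G (a k) = f k \<and> head G (a k) = f (Suc k)" "i \<le> j"
  shows "cas (f i) (map a [i..<j]) (f j) \<and> awalk_verts (f i) (map a [i..<j]) = map f [i..<Suc j]"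
  using assms(2)
proof (induction i rule: inc_induct)
  case base
  then show ?case by simp
next
  case (step n)
  then show ?case
    using assms(1)[of n] by (simp add: upt_conv_Cons del: upt_Suc)
qed

text \<open>Choosing one arc per step turns the sequence into a closed walk; injectivity before the
  closing index makes it a cycle.\<close>

lemma (in wf_digraph) cycle_of_closed_sequence:
  assumes adj: "\<And>k. f k \<rightarrow>\<^bsub>G\<^esub> f (Suc k)" and ij: "i < j" "f i = f j" and inj: "inj_on f {i..<j}"
  shows "\<exists>p. cycle p \<and> length p = j - i"
proof -
  have "\<exists>a. \<forall>k. a k \<in> arcs G \<and> tail G (a k) = f k \<and> head G (a k) = f (Suc k)"
  proof (rule choice, rule allI)
    fix k
    show "\<exists>e. e \<in> arcs G \<and> tail G e = f k \<and> head G e = f (Suc k)"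
      using adj[of k] by (auto simp: arcs_ends_def arc_to_ends_def)
  qed
  then obtain a where a: "a k \<in> arcs G" "tail G (a k) = f k" "head G (a k) = f (Suc k)" for k
    by blast
  let ?p = "map a [i..<j]"
  have p: "cas (f i) ?p (f i)" "awalk_verts (f i) ?p = map f [i..<Suc j]"
    using cas_map_arcs[of a f i j] a ij by auto
  then have "awalk (f i) ?p (f i)"
    using a adj[of i] by (auto simp: awalk_def dest: adj_in_verts)
  moreover have "inj_on f {Suc i..<Suc j}"
  proof (rule inj_onI)
    fix x y assume xy: "x \<in> {Suc i..<Suc j}" "y \<in> {Suc i..<Suc j}" "f x = f y"
    \<comment> \<open>A cycle requires distinct vertices after the first, so the index window is
      shifted by one; \<open>r\<close> moves the closing index \<open>j\<close> back to
      \<open>i\<close>, where \<open>f\<close> has the same value.\<close>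
    define r where "r z = (if z = j then i else z)" for z
    have "f (r x) = f (r y)" "r x \<in> {i..<j}" "r y \<in> {i..<j}"
      using xy ij by (auto simp: r_def)
    then have "r x = r y" using inj by (auto dest: inj_onD)
    then show "x = y" using xy by (auto simp: r_def split: if_splits)
  qed
  then have "distinct (tl (awalk_verts (f i) ?p))"
    using ij(1) unfolding p(2) by (simp add: distinct_map tl_upt flip: map_tl del: upt_Suc)
  ultimately have "cycle ?p"
    using ij unfolding cycle_def by (intro exI[of _ "f i"]) auto
  then show ?thesis by (intro exI[of _ ?p]) simp
qed

text \<open>Otherwise all products \<open>w a * w c\<close> are nonnegative with sum 0, which forces
  \<open>w a * w a = 0\<close>.\<close>

lemma sum_eq_0_opposite_sign:
  fixes w :: "'a \<Rightarrow> real"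
  assumes "finite A" "sum w A = 0" "a \<in> A" "w a \<noteq> 0"
  shows "\<exists>c \<in> A. w a * w c < 0"
proof (rule ccontr)
  assume "\<not> ?thesis"
  then have "\<forall>c\<in>A. w a * w c \<ge> 0" by force
  moreover have "(\<Sum>c\<in>A. w a * w c) = 0" using assms(2) by (simp flip: sum_distrib_left)
  ultimately have "w a * w a = 0"
    using assms(1,3) sum_nonneg_eq_0_iff[of A "\<lambda>c. w a * w c"] by blast
  then show False using assms(4) by simp
qed

text \<open>Otherwise start at an edge inside the support and always leave a vertex towards a neighbour
  whose sign is opposite to that of its predecessor.  The signs along the walk follow the pattern
  \<open>s, t, -s, -t, s, t, -s, -t, \<dots>\<close>, so the first repetition closes a cycle of length divisible
  by 4 (bipartiteness excludes odd lengths).\<close>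

lemma independent_support:
  fixes G :: "('a, 'b) pre_digraph"
  assumes G: "graph G" and C4: "C4k_free_bipartite G"
    and w: "\<And>v. \<lbrakk>v \<in> verts G; w v \<noteq> 0\<rbrakk> \<Longrightarrow> nbsum G w v = 0"
    and uv: "u \<rightarrow>\<^bsub>G\<^esub> v" "w u \<noteq> 0" 
  shows "w v = 0"
proof (rule ccontr)
  assume "w v \<noteq> 0"
  interpret graph G by (rule G)
  \<comment> \<open>The states of the walk are arcs rather than vertices, since the sign of the next
    vertex is dictated by the predecessor of the current one.\<close>
  define P where "P n p \<longleftrightarrow> fst p \<rightarrow>\<^bsub>G\<^esub> snd p \<and> w (fst p) \<noteq> 0 \<and> w (snd p) \<noteq> 0"
    for n :: nat and p
  define Q where "Q n p q \<longleftrightarrow> fst q = snd p \<and> w (fst p) * w (snd q) < 0"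
    for n :: nat and p q :: "'a \<times> 'a"
  have "\<exists>p. P 0 p" using uv \<open>w v \<noteq> 0\<close> by (intro exI[of _ "(u, v)"]) (simp add: P_def)
  moreover have "\<exists>q. P (Suc n) q \<and> Q n p q" if "P n p" for n p
  proof -
    obtain a b where p: "p = (a, b)" by force
    have ab: "a \<rightarrow>\<^bsub>G\<^esub> b" "w a \<noteq> 0" "w b \<noteq> 0" using that by (auto simp: P_def p)
    then have "sum w {c. b \<rightarrow>\<^bsub>G\<^esub> c} = 0"
      using w[of b] adj_in_verts by (auto simp: nbsum_def)
    \<comment> \<open>The predecessor \<open>a\<close> is itself a neighbour of \<open>b\<close>
      with nonzero weight, so the vanishing sum at \<open>b\<close> contains a term of opposite
      sign.\<close>
    then have "\<exists>c \<in> {c. b \<rightarrow>\<^bsub>G\<^esub> c}. w a * w c < 0"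
      using ab finite_neighbours graph_symmetric
      by (intro sum_eq_0_opposite_sign) auto
    then obtain c where c: "b \<rightarrow>\<^bsub>G\<^esub> c" "w a * w c < 0" by blast
    then have "w c \<noteq> 0" by auto
    then show ?thesis
      using c ab by (intro exI[of _ "(b, c)"]) (simp add: P_def Q_def p)
  qed
  ultimately obtain p where p: "\<And>n. P n (p n)" "\<And>n. Q n (p n) (p (Suc n))"
    using dependent_nat_choice[of P Q] by blast
  define f where "f n = fst (p n)" for n
  have snd: "snd (p n) = f (Suc n)" for n
    using p(2)[of n] by (simp add: Q_def f_def)
  have adj: "f n \<rightarrow>\<^bsub>G\<^esub> f (Suc n)" and nz: "w (f n) \<noteq> 0" for n
    using p(1)[of n] by (simp_all add: P_def snd flip: f_def)
  have opp: "w (f n) * w (f (n + 2)) < 0" for n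
    using p(2)[of n] by (simp add: Q_def snd flip: f_def)
  have sign: "0 < (-1) ^ k * (w (f n) * w (f (n + 2 * k)))" for n k
  proof (induction k)
    case 0
    then show ?case using nz[of n] by (auto simp: zero_less_mult_iff linorder_neq_iff)
  next
    case (Suc k)
    have "(-1) ^ k * (w (f n) * w (f (n + 2 * k))) * (w (f (n + 2 * k)) * w (f (n + 2 * k + 2))) < 0"
      using Suc.IH opp by (rule mult_pos_neg)
    \<comment> \<open>The intermediate weight appears squared and can be cancelled.\<close>
    then have "(w (f (n + 2 * k)))\<^sup>2 * ((-1) ^ k * (w (f n) * w (f (n + 2 * k + 2)))) < 0"
      by (simp add: power2_eq_square mult_ac)
    then have "(-1) ^ k * (w (f n) * w (f (n + 2 * k + 2))) < 0"
      by (simp add: mult_less_0_iff)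
    then show ?case by simp
  qed

  obtain X Y where XY: "X \<inter> Y = {}" "\<forall>(u, v) \<in> arcs_ends G. u \<in> X \<and> v \<in> Y \<or> u \<in> Y \<and> v \<in> X"
    using C4 by (auto simp: C4k_free_bipartite_def bipartite_def)
  have alt: "f (Suc n) \<in> X \<longleftrightarrow> f n \<notin> X" for n
    using XY adj[of n] by auto
  have X: "f (n + k) \<in> X \<longleftrightarrow> (f n \<in> X \<longleftrightarrow> even k)" for n k
    by (induction k) (auto simp: alt)

  have "range f \<subseteq> verts G" using adj adj_in_verts by auto
  then have "\<not> inj f"
    using finite_verts by (metis finite_imageD finite_subset infinite_UNIV_nat)
  then have ex: "\<exists>j. \<exists>i<j. f i = f j"
    unfolding inj_def by (metis linorder_neqE_nat)
  \<comment> \<open>The first index at which a vertex recurs; \<open>f\<close> is injective below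
    it.\<close>
  define j where "j = (LEAST j. \<exists>i<j. f i = f j)"
  obtain i where i: "i < j" "f i = f j"
    using LeastI_ex[OF ex] by (auto simp: j_def)
  have "inj_on f {..<j}"
  proof (rule linorder_inj_onI)
    fix x y assume "x < y" "x \<in> {..<j}" "y \<in> {..<j}"
    then show "f x \<noteq> f y"
      using not_less_Least[of y "\<lambda>j. \<exists>i<j. f i = f j"] by (auto simp: j_def)
  qed auto
  then have "inj_on f {i..<j}" by (rule inj_on_subset) auto
  then obtain c where c: "cycle c" "length c = j - i"
    using cycle_of_closed_sequence[of f i j] adj i by blast
  have "even (j - i)" using X[of i "j - i"] i by (cases "f j \<in> X") auto
  then obtain k where k: "j - i = 2 * k" by blast
  then have j: "j = i + 2 * k" using i by simp
  \<comment> \<open>The sign changes \<open>k\<close> times between \<open>i\<close> and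
    \<open>j\<close>, yet both indices carry the same weight, so \<open>k\<close> is even.\<close>
  have "0 < (-1) ^ k * (w (f i) * w (f i))"
    using sign[of k i] i(2) j by simp
  then have "even k"
    using nz[of i] by (cases "even k") (auto simp: zero_less_mult_iff mult_less_0_iff)
  then have "4 dvd j - i" unfolding k by auto
  \<comment> \<open>A positive multiple of 4 is at least 4, so this is not an edge traversed back
    and forth.\<close>
  moreover from this have "3 \<le> j - i" using i(1) by (auto dest: dvd_imp_le)
  ultimately have "undirected_cycle G c \<and> 4 dvd length c"
    using c by (simp add: undirected_cycle_def)
  then show False using C4 unfolding C4k_free_bipartite_def by blast
qed

text \<open>Let \<open>w\<close> be \<open>z\<close> on the colour class of \<open>u\<close> and
  \<open>y\<close> on the other. Neighbours have opposite colours, so where \<open>w\<close> is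
  \<open>z\<close> its neighbour sum is that of \<open>y\<close>, and conversely. These sums vanish
  on the support of \<open>w\<close>, which is therefore independent.\<close>

lemma no_edge_between_supports:
  fixes G :: "('a, 'b) pre_digraph"
  assumes G: "graph G" and C4: "C4k_free_bipartite G"
    and y: "\<And>v. \<lbrakk>v \<in> verts G; z v \<noteq> 0\<rbrakk> \<Longrightarrow> nbsum G y v = 0"
    and z: "\<And>v. \<lbrakk>v \<in> verts G; y v \<noteq> 0\<rbrakk> \<Longrightarrow> nbsum G z v = 0"
    and uv: "u \<rightarrow>\<^bsub>G\<^esub> v" "z u \<noteq> 0"
  shows "y v = 0"
proof -
  interpret graph G by (rule G)
  obtain X Y where XY: "X \<inter> Y = {}" "\<forall>(u, v) \<in> arcs_ends G. u \<in> X \<and> v \<in> Y \<or> u \<in> Y \<and> v \<in> X"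
    using C4 by (auto simp: C4k_free_bipartite_def bipartite_def)
  define w where "w t = (if (t \<in> X) = (u \<in> X) then z t else y t)" for t
  have alt: "s \<in> X \<longleftrightarrow> t \<notin> X" if "t \<rightarrow>\<^bsub>G\<^esub> s" for s t
    using XY that by auto
  have nb: "nbsum G w t = (if (t \<in> X) = (u \<in> X) then nbsum G y t else nbsum G z t)" for t
    unfolding nbsum_def w_def using alt by (auto intro!: sum.cong)
  have "nbsum G w t = 0" if "t \<in> verts G" "w t \<noteq> 0" for t
    using that y[of t] z[of t] unfolding nb by (auto simp: w_def split: if_splits)
  moreover have "w u \<noteq> 0" using uv by (simp add: w_def)
  ultimately have "w v = 0" using independent_support[OF G C4 _ uv(1)] by blast
  then show ?thesis using alt[OF uv(1)] by (simp add: w_def split: if_splits)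
qed

section \<open>Support, core and nullity\<close>

context graph begin

lemma bij_betw_vertex_list: "bij_betw ((!) (vertex_list G)) {..<card (verts G)} (verts G)"
  using bij_betw_nth[of "vertex_list G"] vertex_list[OF finite_verts] by simp

lemma adj_matrix_carrier: "adj_matrix G \<in> carrier_mat (card (verts G)) (card (verts G))"
  by (simp add: adj_matrix_def)

lemma adj_matrix_sym: "(adj_matrix G)\<^sup>T = adj_matrix G"
  using graph_symmetric by (intro eq_matI) (auto simp: adj_matrix_def)

definition fun_of_vec :: "real vec \<Rightarrow> 'a \<Rightarrow> real" where
  "fun_of_vec x v = x $ the_inv_into {..<card (verts G)} ((!) (vertex_list G)) v"

lemma fun_of_vec_nth:
  "i < card (verts G) \<Longrightarrow> fun_of_vec x (vertex_list G ! i) = x $ i"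
  using bij_betw_vertex_list by (simp add: fun_of_vec_def bij_betw_def the_inv_into_f_f)

definition vec_of_fun :: "('a \<Rightarrow> real) \<Rightarrow> real vec" where
  "vec_of_fun f = vec (card (verts G)) (\<lambda>i. f (vertex_list G ! i))"

lemma vec_of_fun_carrier: "vec_of_fun f \<in> carrier_vec (card (verts G))"
  by (simp add: vec_of_fun_def)

lemma vec_of_fun_of_vec:
  "x \<in> carrier_vec (card (verts G)) \<Longrightarrow> vec_of_fun (fun_of_vec x) = x"
  by (intro eq_vecI) (auto simp: vec_of_fun_def fun_of_vec_nth)

lemma all_verts_nth:
  "(\<forall>v\<in>verts G. P v) \<longleftrightarrow> (\<forall>i<card (verts G). P (vertex_list G ! i))"
proof -
  have "verts G = (!) (vertex_list G) ` {..<card (verts G)}"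
    using bij_betw_imp_surj_on[OF bij_betw_vertex_list] by simp
  then have "(\<forall>v\<in>verts G. P v) \<longleftrightarrow> (\<forall>v\<in>(!) (vertex_list G) ` {..<card (verts G)}. P v)"
    by (rule ball_cong) simp
  then show ?thesis by simp (simp add: Ball_def)
qed

lemma adj_matrix_mult_nth:
  assumes "i < card (verts G)"
  shows "(adj_matrix G *\<^sub>v vec_of_fun f) $ i = nbsum G f (vertex_list G ! i)"
proof -
  let ?v = "vertex_list G ! i"
  have "(adj_matrix G *\<^sub>v vec_of_fun f) $ i
      = (\<Sum>j<card (verts G). if ?v \<rightarrow>\<^bsub>G\<^esub> vertex_list G ! j then f (vertex_list G ! j) else 0)"
    using assms by (auto simp: adj_matrix_def vec_of_fun_def scalar_prod_def atLeast0LessThan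
        intro!: sum.cong)
  also have "\<dots> = (\<Sum>u\<in>verts G. if ?v \<rightarrow>\<^bsub>G\<^esub> u then f u else 0)"
    by (rule sum.reindex_bij_betw[OF bij_betw_vertex_list])
  also have "\<dots> = (\<Sum>u\<in>{u\<in>verts G. ?v \<rightarrow>\<^bsub>G\<^esub> u}. f u)"
    by (simp add: sum.If_cases Int_def)
  also have "{u\<in>verts G. ?v \<rightarrow>\<^bsub>G\<^esub> u} = {u. ?v \<rightarrow>\<^bsub>G\<^esub> u}"
    by (auto dest: adj_in_verts)
  finally show ?thesis by (simp add: nbsum_def)
qed

lemma vec_of_fun_in_kernel:
  "vec_of_fun f \<in> mat_kernel (adj_matrix G) \<longleftrightarrow> (\<forall>v\<in>verts G. nbsum G f v = 0)"
  by (simp add: vec_in_kernel_iff[OF adj_matrix_carrier vec_of_fun_carrier] all_verts_nth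
      adj_matrix_mult_nth del: index_mult_mat_vec)

text \<open>Lets arguments about the support work with functions on the vertices instead of vectors
  indexed by an enumeration.\<close>

lemma Supp_iff:
  "v \<in> Supp G \<longleftrightarrow> v \<in> verts G \<and> (\<exists>f. (\<forall>u\<in>verts G. nbsum G f u = 0) \<and> f v \<noteq> 0)"
proof
  assume "v \<in> Supp G"
  then obtain i x where i: "i < card (verts G)" "v = vertex_list G ! i"
    and x: "x \<in> mat_kernel (adj_matrix G)" "x $ i \<noteq> 0"
    unfolding Supp_def by blast
  have "x \<in> carrier_vec (card (verts G))"
    using x(1) mat_kernel_carrier[OF adj_matrix_carrier] by blast
  then have "\<forall>u\<in>verts G. nbsum G (fun_of_vec x) u = 0"
    using x(1) vec_of_fun_in_kernel[of "fun_of_vec x"] by (simp add: vec_of_fun_of_vec)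
  moreover have "fun_of_vec x v \<noteq> 0" using i x by (simp add: fun_of_vec_nth)
  moreover have "v \<in> verts G" using i bij_betw_vertex_list by (auto simp: bij_betw_def)
  ultimately show "v \<in> verts G \<and> (\<exists>f. (\<forall>u\<in>verts G. nbsum G f u = 0) \<and> f v \<noteq> 0)"
    by blast
next
  assume "v \<in> verts G \<and> (\<exists>f. (\<forall>u\<in>verts G. nbsum G f u = 0) \<and> f v \<noteq> 0)"
  then obtain f where v: "v \<in> verts G" and f: "\<forall>u\<in>verts G. nbsum G f u = 0" "f v \<noteq> 0"
    by blast
  obtain i where i: "i < card (verts G)" "v = vertex_list G ! i"
    using v bij_betw_vertex_list by (auto simp: bij_betw_def)
  have "vec_of_fun f $ i \<noteq> 0" using f(2) i by (simp add: vec_of_fun_def)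
  then show "v \<in> Supp G"
    using i f(1) vec_of_fun_in_kernel unfolding Supp_def by blast
qed

lemma Supp_subset: "Supp G \<subseteq> verts G"
  by (auto simp: Supp_iff)

lemma Core_subset: "Core G \<subseteq> verts G"
  by (auto simp: Core_def)

lemma finite_Supp: "finite (Supp G)" and finite_Core: "finite (Core G)"
  using finite_subset[OF _ finite_verts] Supp_subset Core_subset by auto

lemma Core_iff: "v \<in> Core G \<longleftrightarrow> (\<exists>u\<in>Supp G. v \<rightarrow>\<^bsub>G\<^esub> u)"
  by (auto simp: Core_def dest: adj_in_verts)

text \<open>Writes a neighbour sum as a row of a matrix block times a vector, the form used by
  \<open>independent_rows_surj\<close>.\<close>

lemma nbsum_restrict:
  assumes "S \<subseteq> verts G" "\<And>u. u \<notin> S \<Longrightarrow> x u = 0"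
  shows "nbsum G x v = (\<Sum>u\<in>S. (if v \<rightarrow>\<^bsub>G\<^esub> u then 1 else 0) * x u)"
proof -
  have fin: "finite S" using assms(1) finite_verts finite_subset by blast
  have "(\<Sum>u\<in>S. (if v \<rightarrow>\<^bsub>G\<^esub> u then 1 else 0) * x u) = sum x (S \<inter> {u. v \<rightarrow>\<^bsub>G\<^esub> u})"
    using fin by (simp add: sum.If_cases if_distrib[where f = "\<lambda>c. c * _"] cong: if_cong)
  also have "\<dots> = nbsum G x v"
    unfolding nbsum_def using assms(2) finite_neighbours by (intro sum.mono_neutral_left) auto
  finally show ?thesis ..
qed

lemma nbsum_add: "nbsum G (\<lambda>v. x v + y v) v = nbsum G x v + nbsum G y v"
  by (simp add: nbsum_def sum.distrib)

section \<open>Support against core, and the nullity\<close>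

context
  assumes C4: "C4k_free_bipartite G"
begin

text \<open>A common vertex would give an edge joining the supports of two null vectors.\<close>

lemma Supp_Core_disjoint: "Supp G \<inter> Core G = {}"
proof (rule ccontr)
  assume "Supp G \<inter> Core G \<noteq> {}"
  then obtain u v where uv: "u \<in> Supp G" "v \<in> Supp G" "u \<rightarrow>\<^bsub>G\<^esub> v"
    by (auto simp: Core_iff)
  then obtain x y where "\<forall>t\<in>verts G. nbsum G x t = 0" "\<forall>t\<in>verts G. nbsum G y t = 0"
      "x u \<noteq> 0" "y v \<noteq> 0"
    unfolding Supp_iff by blast
  then show False
    using no_edge_between_supports[OF graph_axioms C4, of x y u v] uv(3) by blast
qed

text \<open>A core vertex \<open>c\<close> has a neighbour \<open>u\<close> in the support of some
  null vector \<open>x\<close>. The sums of \<open>x\<close> vanish everywhere and those of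
  \<open>y\<close> vanish wherever \<open>x\<close> does not, so the edge from \<open>u\<close> to
  \<open>c\<close> forces \<open>y c = 0\<close>.\<close>

lemma Core_independent:
  assumes y: "\<And>v. v \<notin> Core G \<Longrightarrow> y v = 0" and s: "\<And>v. v \<in> Supp G \<Longrightarrow> nbsum G y v = 0"
  shows "y c = 0"
proof (cases "c \<in> Core G")
  case True
  then obtain u where u: "u \<in> Supp G" "c \<rightarrow>\<^bsub>G\<^esub> u" by (auto simp: Core_iff)
  then obtain x where x: "\<forall>t\<in>verts G. nbsum G x t = 0" "x u \<noteq> 0"
    unfolding Supp_iff by blast
  show ?thesis
  proof (rule no_edge_between_supports[OF graph_axioms C4])
    show "u \<rightarrow>\<^bsub>G\<^esub> c" using u graph_symmetric by blast
    show "x u \<noteq> 0" by fact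
    show "nbsum G x v = 0" if "v \<in> verts G" for v using x that by blast
    show "nbsum G y v = 0" if "v \<in> verts G" "x v \<noteq> 0" for v
      using x(1) that s Supp_iff by blast
  qed
qed (rule y)

text \<open>By \<open>Core_independent\<close> the core rows of the block between
  \<open>Core G\<close> and \<open>Supp G\<close> are independent, so that block is onto: values on
  the support realise any prescribed neighbour sums at the core.\<close>

lemma Supp_onto_Core:
  "\<exists>z. (\<forall>v. v \<notin> Supp G \<longrightarrow> z v = 0) \<and> (\<forall>c\<in>Core G. nbsum G z c = b c)"
proof -
  let ?m = "\<lambda>c s. if c \<rightarrow>\<^bsub>G\<^esub> s then 1 else 0 :: real"
  have "\<exists>z. \<forall>c\<in>Core G. (\<Sum>s\<in>Supp G. ?m c s * z s) = b c"
  proof (rule independent_rows_surj)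
    show "finite (Core G)" "finite (Supp G)"
      by (rule finite_Core, rule finite_Supp)
    fix y :: "'a \<Rightarrow> real"
    assume y: "\<And>s. s \<in> Supp G \<Longrightarrow> (\<Sum>c\<in>Core G. ?m c s * y c) = 0"
    define y' where "y' v = (if v \<in> Core G then y v else 0)" for v
    have "nbsum G y' s = (\<Sum>c\<in>Core G. ?m c s * y c)" for s
      using Core_subset graph_symmetric
      by (subst nbsum_restrict[of "Core G"]) (auto simp: y'_def intro!: sum.cong)
    then have "y' c = 0" for c
      using y by (intro Core_independent[of y' c]) (simp_all add: y'_def)
    then show "\<forall>c\<in>Core G. y c = 0" unfolding y'_def by metis
  qed
  then obtain z where z: "\<forall>c\<in>Core G. (\<Sum>s\<in>Supp G. ?m c s * z s) = b c" by blast
  define z' where "z' v = (if v \<in> Supp G then z v else 0)" for v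
  have "nbsum G z' c = (\<Sum>s\<in>Supp G. ?m c s * z s)" for c
    using Supp_subset
    by (subst nbsum_restrict[of "Supp G"]) (auto simp: z'_def intro!: sum.cong)
  then show ?thesis using z by (intro exI[of _ z']) (auto simp: z'_def)
qed

text \<open>The kernel is cut out by \<open>x v = 0\<close> for \<open>v\<close> outside the support together with the
  neighbourhood sums at the core vertices, and these conditions are independent.\<close>

lemma kernel_dim_adj_matrix: "kernel_dim (adj_matrix G) + core G = supp G"
proof -
  let ?n = "card (verts G)" and ?V = "vertex_list G"
  \<comment> \<open>One index per linear condition: \<open>Inl v\<close> for the coordinate at
    \<open>v\<close>, \<open>Inr c\<close> for the neighbourhood sum at \<open>c\<close>.\<close>
  define R where "R = Inl ` (verts G - Supp G) \<union> Inr ` Core G"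
  have finR: "finite R"
    using finite_Core by (simp add: R_def)
  have cardR: "card R = ?n - supp G + core G"
    using finite_Supp finite_Core Supp_subset unfolding R_def supp_def core_def
    by (subst card_Un_disjoint) (auto simp: card_image card_Diff_subset)
  have le: "supp G \<le> ?n"
    using Supp_subset finite_verts by (simp add: supp_def card_mono)
  obtain g where g: "bij_betw g {..<card R} R"
    using ex_bij_betw_nat_finite[OF finR] by (auto simp: atLeast0LessThan)
  define cond where "cond r x = (case r of Inl v \<Rightarrow> x v | Inr c \<Rightarrow> nbsum G x c)"
    for r :: "'a + 'a" and x
  \<comment> \<open>The matrix of all conditions; its columns are their values on the indicator
    functions of the vertices.\<close>
  define N where "N = mat (card R) ?n
    (\<lambda>(k, j). cond (g k) (\<lambda>v. if v = ?V ! j then 1 else 0))"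
  have N: "N \<in> carrier_mat (card R) ?n" by (simp add: N_def)
  have gR: "g k \<in> R" if "k < card R" for k using g that by (auto dest: bij_betwE)
  have Nx: "(N *\<^sub>v vec_of_fun x) $ k = cond (g k) x" if k: "k < card R" for x k
  proof -
    have "(N *\<^sub>v vec_of_fun x) $ k
        = (\<Sum>j<?n. cond (g k) (\<lambda>v. if v = ?V ! j then 1 else 0) * x (?V ! j))"
      using k by (simp add: N_def vec_of_fun_def scalar_prod_def atLeast0LessThan)
    also have "\<dots> = (\<Sum>u\<in>verts G. cond (g k) (\<lambda>v. if v = u then 1 else 0) * x u)"
      by (rule sum.reindex_bij_betw[OF bij_betw_vertex_list])
    also have "\<dots> = cond (g k) x"
    proof (cases "g k")
      case (Inl v)
      then have "v \<in> verts G" using gR[OF k] by (auto simp: R_def)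
      then show ?thesis
        using Inl by (simp add: cond_def if_distrib[where f = "\<lambda>c. c * _"] cong: if_cong)
    next
      case (Inr c)
      have "nbsum G (\<lambda>v. if v = u then 1 else 0) c = (if c \<rightarrow>\<^bsub>G\<^esub> u then 1 else 0)" for u
        using finite_neighbours by (simp add: nbsum_def)
      then have "(\<Sum>u\<in>verts G. cond (g k) (\<lambda>v. if v = u then 1 else 0) * x u)
          = (\<Sum>u\<in>verts G. if c \<rightarrow>\<^bsub>G\<^esub> u then x u else 0)"
        using Inr by (auto simp: cond_def intro!: sum.cong)
      also have "\<dots> = nbsum G x c"
        unfolding nbsum_def by (subst sum.If_cases) (auto dest: adj_in_verts intro!: sum.cong)
      finally show ?thesis using Inr by (simp add: cond_def)
    qed
    finally show ?thesis .
  qed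
  have onR: "(\<forall>k<card R. P (g k)) \<longleftrightarrow> (\<forall>r\<in>R. P r)" for P
  proof -
    have "(\<forall>r\<in>g ` {..<card R}. P r) \<longleftrightarrow> (\<forall>r\<in>R. P r)"
      by (simp only: bij_betw_imp_surj_on[OF g])
    then show ?thesis by simp (simp add: Ball_def)
  qed
  have "kernel_dim N + card R = ?n"
  proof (rule kernel_dim_surj[OF N])
    fix y :: "real vec" assume y: "y \<in> carrier_vec (card R)"
    define h where "h r = y $ the_inv_into {..<card R} g r" for r
    have h: "h (g k) = y $ k" if "k < card R" for k
      using g that by (simp add: h_def bij_betw_def the_inv_into_f_f)
    \<comment> \<open>\<open>x\<close> meets the coordinate conditions. The correction
      \<open>z\<close> lives on the support, so it adjusts the sums at the core without disturbing
      them.\<close>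
    define x where "x v = (if v \<in> verts G - Supp G then h (Inl v) else 0)" for v
    obtain z where z: "\<forall>v. v \<notin> Supp G \<longrightarrow> z v = 0"
        "\<forall>c\<in>Core G. nbsum G z c = h (Inr c) - nbsum G x c"
      using Supp_onto_Core[of "\<lambda>c. h (Inr c) - nbsum G x c"] by blast
    have "x v + z v = h (Inl v)" if "v \<in> verts G - Supp G" for v
      using that z(1) by (simp add: x_def)
    moreover have "nbsum G (\<lambda>v. x v + z v) c = h (Inr c)" if "c \<in> Core G" for c
      using that z(2) by (simp add: nbsum_add)
    ultimately have "\<forall>r\<in>R. cond r (\<lambda>v. x v + z v) = h r"
      by (auto simp: R_def cond_def)
    then have "\<forall>k<card R. cond (g k) (\<lambda>v. x v + z v) = y $ k"
      using h gR by metis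
    then have "N *\<^sub>v vec_of_fun (\<lambda>v. x v + z v) = y"
      using y N by (intro eq_vecI) (auto simp: Nx simp del: index_mult_mat_vec)
    then show "\<exists>x\<in>carrier_vec ?n. N *\<^sub>v x = y"
      using vec_of_fun_carrier by blast
  qed
  moreover have "mat_kernel N = mat_kernel (adj_matrix G)"
  proof -
    have "vec_of_fun x \<in> mat_kernel N \<longleftrightarrow> vec_of_fun x \<in> mat_kernel (adj_matrix G)" for x
    proof -
      have "vec_of_fun x \<in> mat_kernel N \<longleftrightarrow> (\<forall>k<card R. (N *\<^sub>v vec_of_fun x) $ k = 0)"
        by (rule vec_in_kernel_iff[OF N vec_of_fun_carrier])
      also have "\<dots> \<longleftrightarrow> (\<forall>k<card R. cond (g k) x = 0)"
        using Nx by presburger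
      also have "\<dots> \<longleftrightarrow> (\<forall>r\<in>R. cond r x = 0)" by (rule onR)
      also have "\<dots> \<longleftrightarrow> (\<forall>v\<in>verts G - Supp G. x v = 0) \<and> (\<forall>c\<in>Core G. nbsum G x c = 0)"
        by (simp add: R_def cond_def ball_Un)
      also have "\<dots> \<longleftrightarrow> (\<forall>v\<in>verts G. nbsum G x v = 0)"
      proof safe
        fix v assume x: "\<forall>v\<in>verts G - Supp G. x v = 0" "\<forall>c\<in>Core G. nbsum G x c = 0"
          and v: "v \<in> verts G"
        show "nbsum G x v = 0"
        proof (cases "v \<in> Core G")
          \<comment> \<open>Outside the core no neighbour lies in the support, so every term of the
            sum is 0.\<close>
          case False
          then have "x u = 0" if "v \<rightarrow>\<^bsub>G\<^esub> u" for u
            using that x(1) adj_in_verts[OF that] by (auto simp: Core_iff)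
          then show ?thesis by (simp add: nbsum_def)
        qed (use x in blast)
      qed (use Supp_iff Core_subset in blast)+
      finally show ?thesis by (simp only: vec_of_fun_in_kernel)
    qed
    moreover have "mat_kernel N \<subseteq> carrier_vec ?n" "mat_kernel (adj_matrix G) \<subseteq> carrier_vec ?n"
      using mat_kernel_carrier[OF N] mat_kernel_carrier[OF adj_matrix_carrier] .
    ultimately show ?thesis
      using vec_of_fun_of_vec by (metis subset_iff subset_antisym)
  qed
  then have "kernel_dim N = kernel_dim (adj_matrix G)"
    using N adj_matrix_carrier by (simp add: kernel_dim_def)
  ultimately show ?thesis using cardR le by simp
qed

end

section \<open>Inertia of bipartite graphs\<close>

text \<open>Conjugation by the diagonal matrix with 1 on one colour class and -1 on the other, which
  is its own inverse, changes the sign of every entry because edges join opposite classes.\<close>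

lemma adj_matrix_similar_uminus:
  assumes "bipartite G"
  shows "similar_mat (adj_matrix G) ((-1) \<cdot>\<^sub>m adj_matrix G)"
proof -
  obtain X Y where XY: "X \<inter> Y = {}" "\<forall>(u, v) \<in> arcs_ends G. u \<in> X \<and> v \<in> Y \<or> u \<in> Y \<and> v \<in> X"
    using assms by (auto simp: bipartite_def)
  have alt: "u \<in> X \<longleftrightarrow> v \<notin> X" if "u \<rightarrow>\<^bsub>G\<^esub> v" for u v
    using XY that by auto
  let ?n = "card (verts G)"
  define D :: "real mat" where "D = mat_diag ?n (\<lambda>i. if vertex_list G ! i \<in> X then 1 else -1)"
  have D: "D \<in> carrier_mat ?n ?n" by (simp add: D_def)
  have DD: "D * D = 1\<^sub>m ?n"
    by (simp add: D_def mat_diag_mult_left[of _ ?n ?n]) (auto intro!: eq_matI simp: mat_diag_def)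
  have "D * ((-1) \<cdot>\<^sub>m adj_matrix G) * D = adj_matrix G"
    unfolding D_def using adj_matrix_carrier alt
    by (subst mat_diag_mult_left[of _ ?n ?n], simp, subst mat_diag_mult_right[of _ ?n ?n], simp)
      (auto simp: adj_matrix_def intro!: eq_matI)
  then have "similar_mat_wit (adj_matrix G) ((-1) \<cdot>\<^sub>m adj_matrix G) D D"
    using D DD adj_matrix_carrier by (intro similar_mat_witI[of _ _ ?n]) auto
  then show ?thesis by (auto simp: similar_mat_def)
qed

text \<open>Negation pairs negative with positive eigenvalues of equal multiplicity, 0 has the
  nullity as multiplicity, and all multiplicities add up to the order.\<close>

lemma inertia_bipartite:
  assumes "bipartite G"
  shows "\<exists>a. inertia G = (a, kernel_dim (adj_matrix G), a)
    \<and> 2 * a + kernel_dim (adj_matrix G) = card (verts G)"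
proof -
  let ?A = "adj_matrix G"
  let ?p = "char_poly ?A"
  let ?m = "\<lambda>k. Polynomial.order k ?p"
  obtain as where as: "?p = (\<Prod>a\<leftarrow>as. [:- a, 1:])"
    using symmetric_real_char_poly_splits[OF adj_matrix_carrier adj_matrix_sym] by blast
  obtain n_as where jnf: "jordan_nf ?A n_as"
    using as jordan_nf_exists[OF adj_matrix_carrier] by blast
  have p0: "?p \<noteq> 0" unfolding as by (auto simp: prod_list_zero_iff)
  have ev: "eigenvalue ?A k \<longleftrightarrow> poly ?p k = 0" for k
    using eigenvalue_root_char_poly[OF adj_matrix_carrier] by simp
  have fin: "finite {k. poly ?p k = 0}" by (rule poly_roots_finite[OF p0])
  have sym: "?m (- k) = ?m k" for k
    using order_char_poly_uminus[OF adj_matrix_carrier jnf adj_matrix_similar_uminus[OF assms]] .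
  have root: "poly ?p k = 0 \<longleftrightarrow> ?m k \<noteq> 0" for k
    using order_root[of ?p k] p0 by simp
  let ?neg = "{k. poly ?p k = 0 \<and> k < 0}" and ?pos = "{k. poly ?p k = 0 \<and> k > 0}"
  have "sum ?m ?neg = sum ?m ?pos"
    by (rule sum.reindex_bij_witness[of _ uminus uminus]) (auto simp: root sym)
  moreover have "sum ?m {k. poly ?p k = 0} = card (verts G)"
  proof -
    have "degree ?p = sum ?m {k. poly ?p k = 0}"
      unfolding as by (rule sum_order_split_poly[symmetric])
    then show ?thesis using degree_monic_char_poly[OF adj_matrix_carrier] by simp
  qed
  moreover have "sum ?m {k. poly ?p k = 0} = sum ?m ?neg + (?m 0 + sum ?m ?pos)"
  proof -
    \<comment> \<open>Inserting 0 is harmless even if it is not a root, since its order is then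
      0.\<close>
    have "sum ?m {k. poly ?p k = 0} = sum ?m (insert 0 (?neg \<union> ?pos))"
      by (rule sum.mono_neutral_left) (use fin in \<open>auto simp: root\<close>)
    also have "\<dots> = ?m 0 + (sum ?m ?neg + sum ?m ?pos)"
      using fin by (subst sum.insert) (auto intro!: sum.union_disjoint)
    finally show ?thesis by simp
  qed
  moreover have "?m 0 = kernel_dim ?A"
    by (rule symmetric_real_order_0_char_poly[OF adj_matrix_carrier adj_matrix_sym])
  ultimately show ?thesis
    by (simp add: inertia_def Let_def ev)
qed

lemma inertia_C4k_free_bipartite:
  assumes C4: "C4k_free_bipartite G"
  shows "\<exists>k. npart G = 2 * k \<and> core G \<le> supp G
    \<and> inertia G = (core G + k, supp G - core G, core G + k)"
proof -
  obtain a where a: "inertia G = (a, kernel_dim (adj_matrix G), a)"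
    "2 * a + kernel_dim (adj_matrix G) = card (verts G)"
    using inertia_bipartite C4 by (auto simp: C4k_free_bipartite_def)
  have "card (verts G) = supp G + core G + npart G"
  proof -
    have "card (Supp G \<union> Core G) = supp G + core G"
      using finite_Supp finite_Core Supp_Core_disjoint[OF C4] by (simp add: card_Un_disjoint supp_def core_def)
    moreover have "card (verts G) = card (Supp G \<union> Core G) + npart G"
      unfolding npart_def Npart_def
      using card_Un_disjoint[of "Supp G \<union> Core G" "verts G - (Supp G \<union> Core G)"]
        Supp_subset Core_subset finite_Supp finite_Core finite_verts
      by (simp add: Un_absorb1)
    ultimately show ?thesis by simp
  qed
  then show ?thesis
    using a kernel_dim_adj_matrix[OF C4]
    \<comment> \<open>With order \<open>supp G + core G + npart G\<close> and nullity
      \<open>supp G - core G\<close>, one gets \<open>2 * a = 2 * core G + npart G\<close>.\<close>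
    by (intro exI[of _ "a - core G"]) auto
qed

end

section \<open>Connected components\<close>

lemma induced_subgraph_trans:
  assumes "induced_subgraph H F" "induced_subgraph F G"
  shows "induced_subgraph H G"
proof -
  have "subgraph H G"
    using assms subgraph_trans unfolding induced_subgraph_def by metis
  moreover have "verts H \<subseteq> verts F" "tail F = tail G" "head F = head G"
    using assms by (auto simp: induced_subgraph_def subgraph_def compatible_def)
  ultimately show ?thesis
    using assms unfolding induced_subgraph_def by auto
qed

lemma induced_subgraph_adj:
  assumes "induced_subgraph H G"
  shows "u \<rightarrow>\<^bsub>H\<^esub> v \<longleftrightarrow> u \<rightarrow>\<^bsub>G\<^esub> v \<and> u \<in> verts H \<and> v \<in> verts H"
proof -
  have "tail H = tail G" "head H = head G"
    and "arcs H = {e \<in> arcs G. tail G e \<in> verts H \<and> head G e \<in> verts H}"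
    using assms by (simp_all add: induced_subgraph_def subgraph_def compatible_def)
  then show ?thesis by (auto simp: arcs_ends_def arc_to_ends_def)
qed

lemma graph_induced_subgraph:
  assumes "graph G" "induced_subgraph H G"
  shows "graph H"
proof -
  interpret graph G by fact
  interpret H: digraph H using assms(2) by (rule digraphI_induced)
  interpret H: sym_digraph H using assms(2) by (rule induced_graph_imp_graph)
  show ?thesis by unfold_locales
qed

lemma C4k_free_bipartite_induced_subgraph:
  assumes "graph G" "C4k_free_bipartite G" "induced_subgraph H G"
  shows "C4k_free_bipartite H"
proof -
  interpret graph G by fact
  have sub: "subgraph H G" using assms(3) by blast
  obtain X Y where XY: "X \<union> Y = verts G" "X \<inter> Y = {}"
      "\<forall>(u, v) \<in> arcs_ends G. u \<in> X \<and> v \<in> Y \<or> u \<in> Y \<and> v \<in> X"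
    using assms(2) by (auto simp: C4k_free_bipartite_def bipartite_def)
  have "X \<inter> verts H \<union> Y \<inter> verts H = verts H"
    using XY(1) subgraph_imp_subverts[OF sub] by blast
  moreover have "\<forall>(u, v) \<in> arcs_ends H. u \<in> X \<inter> verts H \<and> v \<in> Y \<inter> verts H
      \<or> u \<in> Y \<inter> verts H \<and> v \<in> X \<inter> verts H"
    using XY(3) induced_subgraph_adj[OF assms(3)] by fast
  ultimately have "bipartite H"
    using XY(2) unfolding bipartite_def by blast
  then show ?thesis
    using assms(2) subgraph_cycle[OF sub]
    by (auto simp: C4k_free_bipartite_def undirected_cycle_def)
qed

lemma nbsum_induced_subgraph:
  assumes "graph G" "induced_subgraph H G" "t \<in> verts H"
    and "\<And>u. \<lbrakk>t \<rightarrow>\<^bsub>G\<^esub> u; u \<notin> verts H\<rbrakk> \<Longrightarrow> x u = 0"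
  shows "nbsum H x t = nbsum G x t"
proof -
  interpret graph G by fact
  show ?thesis
    unfolding nbsum_def using assms(3,4) finite_neighbours
    by (intro sum.mono_neutral_left) (auto simp: induced_subgraph_adj[OF assms(2)])
qed

context graph begin

lemma sccs_eq_components: "sccs = components G"
  by (rule components_eq_sccs[OF sym_digraph_axioms, symmetric])

lemma finite_components: "finite (components G)"
  unfolding sccs_eq_components[symmetric] sccs_conv_sccs_verts
  by (rule finite_imageI[OF finite_sccs_verts])

lemma component_induced: "H \<in> components G \<Longrightarrow> induced_subgraph H G"
  unfolding sccs_eq_components[symmetric] by (rule in_sccs_imp_induced)

text \<open>Adjacent vertices reach each other in both directions, hence lie in the same strongly
  connected component.\<close>

lemma component_closed:
  assumes "H \<in> components G" "u \<in> verts H" "u \<rightarrow>\<^bsub>G\<^esub> v"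
  shows "v \<in> verts H"
proof -
  have "verts H \<in> sccs_verts"
    using assms(1) by (auto simp: sccs_verts_conv sccs_eq_components)
  moreover have "u \<rightarrow>\<^sup>*\<^bsub>G\<^esub> v" "v \<rightarrow>\<^sup>*\<^bsub>G\<^esub> u"
    using assms(3) graph_symmetric by (auto intro: reachable_adjI)
  ultimately show ?thesis
    using assms(2) unfolding in_sccs_verts_conv_reachable by blast
qed

text \<open>The vertex sets of the components partition the vertices, and so cut \<open>S\<close>
  into disjoint pieces.\<close>

lemma sum_card_components:
  assumes "S \<subseteq> verts G"
  shows "(\<Sum>H\<in>components G. card (S \<inter> verts H)) = card S"
proof -
  have "\<exists>H\<in>components G. v \<in> verts H" if "v \<in> S" for v
    using scc_for_vert_ex[of v] that assms unfolding sccs_eq_components by blast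
  then have "(\<Union>H\<in>components G. S \<inter> verts H) = S" by blast
  moreover have "card (\<Union>H\<in>components G. S \<inter> verts H) = (\<Sum>H\<in>components G. card (S \<inter> verts H))"
  proof (rule card_UN_disjoint[OF finite_components])
    show "\<forall>H\<in>components G. finite (S \<inter> verts H)"
      using assms finite_verts finite_subset by blast
    show "\<forall>H\<in>components G. \<forall>K\<in>components G. H \<noteq> K \<longrightarrow> (S \<inter> verts H) \<inter> (S \<inter> verts K) = {}"
    proof (intro ballI impI)
      fix H K assume "H \<in> components G" "K \<in> components G" "H \<noteq> K"
      then have "verts H \<inter> verts K = {}" by (intro scc_disj) (simp_all add: sccs_eq_components)
      then show "(S \<inter> verts H) \<inter> (S \<inter> verts K) = {}" by blast
    qed
  qed
  ultimately show ?thesis by simp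
qed

end

section \<open>Components of \<open>C_S G\<close> and \<open>C_N G\<close>\<close>

locale C4k_free_bipartite_graph = graph +
  assumes C4: "C4k_free_bipartite G"
begin

lemma C_S_induced: "induced_subgraph (C_S G) G"
  unfolding C_S_def by (rule induced_induce[OF Un_least[OF Supp_subset Core_subset]])

lemma C_N_induced: "induced_subgraph (C_N G) G"
  unfolding C_N_def Npart_def by (rule induced_induce[OF Diff_subset])

lemma graph_C_S: "graph (C_S G)"
  by (rule graph_induced_subgraph[OF graph_axioms C_S_induced])

lemma graph_C_N: "graph (C_N G)"
  by (rule graph_induced_subgraph[OF graph_axioms C_N_induced])

lemma verts_C_S: "verts (C_S G) = Supp G \<union> Core G"
  by (simp add: C_S_def)

lemma verts_C_N: "verts (C_N G) = Npart G"
  by (simp add: C_N_def)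

context
  fixes H assumes H: "H \<in> components (C_S G)"
begin

lemma C_S_component_induced: "induced_subgraph H G"
  using graph.component_induced[OF graph_C_S H] C_S_induced by (rule induced_subgraph_trans)

lemma graph_C_S_component: "graph H"
  by (rule graph_induced_subgraph[OF graph_axioms C_S_component_induced])

lemma C_S_component_verts: "verts H \<subseteq> Supp G \<union> Core G"
  using subgraph_imp_subverts[OF induced_imp_subgraph[OF graph.component_induced[OF graph_C_S H]]]
  by (simp only: verts_C_S)

lemma C_S_component_closed:
  assumes "u \<in> verts H" "u \<rightarrow>\<^bsub>G\<^esub> v" "v \<in> Supp G \<union> Core G"
  shows "v \<in> verts H"
proof (rule graph.component_closed[OF graph_C_S H assms(1)])
  show "u \<rightarrow>\<^bsub>C_S G\<^esub> v"
    using assms C_S_component_verts by (auto simp: induced_subgraph_adj[OF C_S_induced] verts_C_S)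
qed

text \<open>A null vector of \<open>G\<close> stays null on \<open>H\<close> because the support
  neighbours of vertices of \<open>H\<close> lie in \<open>H\<close>. Conversely, the zero extension
  of a null vector of \<open>H\<close> has vanishing sums on \<open>Supp G\<close>. It is therefore
  0 at every core vertex, leaving only vertices of \<open>Supp G\<close> for
  \<open>Supp H\<close>.\<close>

lemma Supp_C_S_component: "Supp H = Supp G \<inter> verts H"
proof (intro equalityI subsetI)
  fix v assume "v \<in> Supp G \<inter> verts H"
  then obtain x where x: "\<forall>u\<in>verts G. nbsum G x u = 0" "x v \<noteq> 0" and v: "v \<in> verts H"
    using Supp_iff by blast
  have "nbsum H x t = 0" if t: "t \<in> verts H" for t
  proof -
    have "x u = 0" if u: "t \<rightarrow>\<^bsub>G\<^esub> u" "u \<notin> verts H" for u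
    proof (rule ccontr)
      assume "x u \<noteq> 0"
      then have "u \<in> Supp G" using x(1) adj_in_verts[OF u(1)] Supp_iff by blast
      then show False using C_S_component_closed[OF t u(1)] u(2) by blast
    qed
    then have "nbsum H x t = nbsum G x t"
      by (rule nbsum_induced_subgraph[OF graph_axioms C_S_component_induced t])
    then show ?thesis
      using x(1) t C_S_component_verts Supp_subset Core_subset by auto
  qed
  then show "v \<in> Supp H" using x(2) v graph.Supp_iff[OF graph_C_S_component] by blast
next
  fix v assume "v \<in> Supp H"
  then obtain y where y: "\<forall>u\<in>verts H. nbsum H y u = 0" "y v \<noteq> 0" and v: "v \<in> verts H"
    using graph.Supp_iff[OF graph_C_S_component] by blast
  have "v \<notin> Core G"
  proof
    assume "v \<in> Core G"
    then obtain u where u: "u \<in> Supp G" "v \<rightarrow>\<^bsub>G\<^esub> u" by (auto simp: Core_iff)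
    then obtain z where z: "\<forall>t\<in>verts G. nbsum G z t = 0" "z u \<noteq> 0"
      using Supp_iff by blast
    define y' where "y' t = (if t \<in> verts H then y t else 0)" for t
    have "nbsum G y' t = 0" if t: "t \<in> Supp G" for t
    proof (cases "t \<in> verts H")
      case True
      then have "nbsum G y' t = nbsum H y' t"
        by (intro nbsum_induced_subgraph[symmetric, OF graph_axioms C_S_component_induced])
          (auto simp: y'_def)
      also have "\<dots> = nbsum H y t"
        unfolding nbsum_def
        by (intro sum.cong) (auto simp: y'_def induced_subgraph_adj[OF C_S_component_induced])
      finally show ?thesis using y(1) True by simp
    next
      \<comment> \<open>A neighbour in \<open>H\<close> would pull the support vertex
        \<open>t\<close> into \<open>H\<close>.\<close>
      case False
      have "y' s = 0" if "t \<rightarrow>\<^bsub>G\<^esub> s" for s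
        using False t C_S_component_closed[of s t] graph_symmetric[OF that] by (auto simp: y'_def)
      then show ?thesis by (simp add: nbsum_def)
    qed
    moreover have "t \<in> Supp G" if "t \<in> verts G" "z t \<noteq> 0" for t
      using that z(1) Supp_iff by blast
    ultimately have "y' v = 0"
      using z no_edge_between_supports[OF graph_axioms C4 _ _ graph_symmetric[OF u(2)], of z y']
      by blast
    then show False using y(2) v by (simp add: y'_def)
  qed
  then show "v \<in> Supp G \<inter> verts H" using v C_S_component_verts by blast
qed

lemma Core_C_S_component: "Core H = Core G \<inter> verts H"
proof (intro equalityI subsetI)
  fix c assume "c \<in> Core H"
  then obtain u where "u \<in> Supp H" "c \<rightarrow>\<^bsub>H\<^esub> u" using graph.Core_iff[OF graph_C_S_component] by blast
  then show "c \<in> Core G \<inter> verts H"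
    by (auto simp: Supp_C_S_component Core_iff induced_subgraph_adj[OF C_S_component_induced])
next
  fix c assume "c \<in> Core G \<inter> verts H"
  then obtain u where u: "u \<in> Supp G" "c \<rightarrow>\<^bsub>G\<^esub> u" and c: "c \<in> verts H"
    using Core_iff by blast
  then have "u \<in> verts H" using C_S_component_closed by blast
  then show "c \<in> Core H"
    using u c by (auto simp: Supp_C_S_component graph.Core_iff[OF graph_C_S_component]
        induced_subgraph_adj[OF C_S_component_induced])
qed

text \<open>Support and core of \<open>G\<close> cover \<open>H\<close>, so \<open>Npart H\<close>
  is empty and its term drops out of the inertia formula.\<close>

lemma inertia_C_S_component:
  "core H \<le> supp H \<and> inertia H = (core H, supp H - core H, core H)"
proof -
  have "Npart H = {}"
    using C_S_component_verts by (auto simp: Npart_def Supp_C_S_component Core_C_S_component)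
  then have "npart H = 0" by (simp add: npart_def)
  then show ?thesis
    using graph.inertia_C4k_free_bipartite[OF graph_C_S_component]
      C4k_free_bipartite_induced_subgraph[OF graph_axioms C4 C_S_component_induced] by auto
qed

end

context
  fixes H assumes H: "H \<in> components (C_N G)"
begin

lemma C_N_component_induced: "induced_subgraph H G"
  using graph.component_induced[OF graph_C_N H] C_N_induced by (rule induced_subgraph_trans)

lemma graph_C_N_component: "graph H"
  by (rule graph_induced_subgraph[OF graph_axioms C_N_component_induced])

lemma C_N_component_verts: "verts H \<subseteq> Npart G"
  using subgraph_imp_subverts[OF induced_imp_subgraph[OF graph.component_induced[OF graph_C_N H]]]
  by (simp only: verts_C_N)

text \<open>A null vector of a component of \<open>C_N G\<close> extends to a null vector of \<open>G\<close>: values on the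
  support can be chosen to cancel its neighbourhood sums at the core.\<close>

lemma Supp_C_N_component: "Supp H = {}"
proof (rule ccontr)
  assume "Supp H \<noteq> {}"
  then obtain v where "v \<in> Supp H" by blast
  then obtain y where y: "\<forall>u\<in>verts H. nbsum H y u = 0" "y v \<noteq> 0" and v: "v \<in> verts H"
    using graph.Supp_iff[OF graph_C_N_component] by blast
  define y' where "y' t = (if t \<in> verts H then y t else 0)" for t
  obtain z where z: "\<And>t. t \<notin> Supp G \<Longrightarrow> z t = 0"
      "\<And>c. c \<in> Core G \<Longrightarrow> nbsum G z c = - nbsum G y' c"
    using Supp_onto_Core[OF C4, of "\<lambda>c. - nbsum G y' c"] by blast
  have y'0: "nbsum G y' t = 0" if t: "t \<in> verts G" "t \<notin> Core G" for t
  proof (cases "t \<in> verts H")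
    case True
    then have "nbsum G y' t = nbsum H y' t"
      by (intro nbsum_induced_subgraph[symmetric, OF graph_axioms C_N_component_induced])
        (auto simp: y'_def)
    also have "\<dots> = nbsum H y t"
      unfolding nbsum_def
      by (intro sum.cong) (auto simp: y'_def induced_subgraph_adj[OF C_N_component_induced])
    finally show ?thesis using y(1) True by simp
  next
    case False
    \<comment> \<open>Such an \<open>s\<close> lies in \<open>Npart G\<close>, so \<open>t\<close>
      is not in the support; being outside the core as well, \<open>t\<close> is in
      \<open>Npart G\<close> and would belong to the same component as \<open>s\<close>.\<close>
    have "s \<notin> verts H" if s: "t \<rightarrow>\<^bsub>G\<^esub> s" for s
    proof
      assume sH: "s \<in> verts H"
      then have sN: "s \<in> Npart G" using C_N_component_verts by blast
      have st: "s \<rightarrow>\<^bsub>G\<^esub> t" by (rule graph_symmetric[OF s])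
      then have "t \<notin> Supp G" using sN Core_iff by (auto simp: Npart_def)
      then have "t \<in> Npart G" using t by (simp add: Npart_def)
      then have "s \<rightarrow>\<^bsub>C_N G\<^esub> t"
        using st sN by (simp add: induced_subgraph_adj[OF C_N_induced] verts_C_N)
      then show False using graph.component_closed[OF graph_C_N H sH] False by blast
    qed
    then show ?thesis by (simp add: nbsum_def y'_def)
  qed
  \<comment> \<open>\<open>z\<close> lives on the support, and only core vertices have neighbours
    there.\<close>
  have z0: "nbsum G z t = 0" if "t \<notin> Core G" for t
    using that z(1) Core_iff unfolding nbsum_def by (intro sum.neutral) blast
  have "\<forall>t\<in>verts G. nbsum G (\<lambda>t. y' t + z t) t = 0"
  proof
    fix t assume t: "t \<in> verts G"
    show "nbsum G (\<lambda>t. y' t + z t) t = 0"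
      by (cases "t \<in> Core G") (simp_all add: nbsum_add z(2) y'0[OF t] z0)
  qed
  moreover have "v \<notin> Supp G" using v C_N_component_verts by (auto simp: Npart_def)
  \<comment> \<open>At \<open>v\<close> the correction is 0, so the extended null vector would put
    \<open>v\<close> in \<open>Supp G\<close>.\<close>
  moreover from this have "y' v + z v \<noteq> 0" using v y(2) z(1) by (simp add: y'_def)
  moreover have "v \<in> verts G" using v C_N_component_verts by (auto simp: Npart_def)
  ultimately show False using Supp_iff by blast
qed

text \<open>Without support there is no core, so all vertices of \<open>H\<close> belong to
  \<open>Npart H\<close>.\<close>

lemma inertia_C_N_component:
  "\<exists>k. card (verts H) = 2 * k \<and> inertia H = (k, 0, k)"
proof -
  have "Core H = {}" using Supp_C_N_component graph.Core_iff[OF graph_C_N_component] by blast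
  then have "supp H = 0" "core H = 0" "npart H = card (verts H)"
    by (simp_all add: supp_def core_def npart_def Npart_def Supp_C_N_component)
  then show ?thesis
    using graph.inertia_C4k_free_bipartite[OF graph_C_N_component]
      C4k_free_bipartite_induced_subgraph[OF graph_axioms C4 C_N_component_induced] by auto
qed

end

lemma sum_inertia_C_S:
  "(\<Sum>H\<in>components (C_S G). inertia H) = (core G, supp G - core G, core G)"
proof -
  let ?K = "components (C_S G)"
  have core: "(\<Sum>H\<in>?K. core H) = core G"
    using graph.sum_card_components[OF graph_C_S, of "Core G"] Core_C_S_component
    by (simp add: core_def verts_C_S)
  have supp: "(\<Sum>H\<in>?K. supp H) = supp G"
    using graph.sum_card_components[OF graph_C_S, of "Supp G"] Supp_C_S_component
    by (simp add: supp_def verts_C_S)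
  \<comment> \<open>Truncated subtraction commutes with the sum because
    \<open>core H \<le> supp H\<close> in every component.\<close>
  have "(\<Sum>H\<in>?K. supp H - core H) = supp G - core G"
    using inertia_C_S_component by (subst sum_subtractf_nat) (simp_all add: core supp)
  moreover have "(\<Sum>H\<in>?K. inertia H) = (\<Sum>H\<in>?K. (core H, supp H - core H, core H))"
    using inertia_C_S_component by (intro sum.cong) auto
  ultimately show ?thesis by (simp add: sum_prod core)
qed

lemma sum_inertia_C_N:
  "(\<Sum>H\<in>components (C_N G). inertia H) = (npart G div 2, 0, npart G div 2)"
proof -
  let ?K = "components (C_N G)"
  have H: "card (verts H) = 2 * (card (verts H) div 2)
      \<and> inertia H = (card (verts H) div 2, 0, card (verts H) div 2)" if "H \<in> ?K" for H
    using inertia_C_N_component[OF that] by auto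
  \<comment> \<open>Every component has even order, so halving commutes with the sum.\<close>
  have "2 * (\<Sum>H\<in>?K. card (verts H) div 2) = (\<Sum>H\<in>?K. card (verts H))"
    unfolding sum_distrib_left using H by (intro sum.cong) auto
  also have "\<dots> = (\<Sum>H\<in>?K. card (Npart G \<inter> verts H))"
    using C_N_component_verts by (intro sum.cong) (auto simp: Int_absorb1)
  also have "\<dots> = npart G"
    by (simp add: graph.sum_card_components[OF graph_C_N] verts_C_N npart_def)
  finally have "(\<Sum>H\<in>?K. card (verts H) div 2) = npart G div 2" by simp
  moreover have "(\<Sum>H\<in>?K. inertia H) = (\<Sum>H\<in>?K. (card (verts H) div 2, 0, card (verts H) div 2))"
    using H by (intro sum.cong) auto
  ultimately show ?thesis by (simp add: sum_prod)
qed

end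

theorem theorem7p2:
  fixes G :: "('a, 'b) pre_digraph"
  assumes "graph G"
    and "C4k_free_bipartite G"
  shows "map_prod real (map_prod real real) (inertia G) =
      (real (core G) + real (npart G) / 2,
       real (supp G) - real (core G),
       real (core G) + real (npart G) / 2) \<and>
    inertia G = (\<Sum>H \<in> components (C_S G). inertia H) + (\<Sum>H \<in> components (C_N G). inertia H)"
proof -
  interpret C4k_free_bipartite_graph G
    using assms by (simp add: C4k_free_bipartite_graph_def C4k_free_bipartite_graph_axioms_def)
  \<comment> \<open>Evenness and \<open>core G \<le> supp G\<close> make division and subtraction of
    naturals agree with the real ones.\<close>
  obtain k where "npart G = 2 * k" "core G \<le> supp G"
      "inertia G = (core G + k, supp G - core G, core G + k)"
    using inertia_C4k_free_bipartite[OF C4] by blast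
  then show ?thesis by (simp add: sum_inertia_C_S sum_inertia_C_N)
qed

end
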